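(* Let $n\ge 2$. For every scalar symbol $\xi\in\mathcal F_n^2$ (that is, for every vector $\xi$ of the full Fock space $\mathcal F_n^2$), the $C^*$-algebra $\mathcal A_\xi=C^*(S_1,\dots,S_n,W_\xi)\subseteq\mathcal B(\mathcal F_n^2)$ contains all compact operators: $\mathcal K(\mathcal F_n^2)\subseteq\mathcal A_\xi$.
   Context: Full Fock space: $\mathcal F_n^2=\mathbb C\Omega\oplus\bigoplus_{m\ge1}(\mathbb C^n)^{\otimes m}$, with canonical orthonormal basis $\{e_\mu:\mu\in\mathbb F_n^+\}$, where $\mathbb F_n^+$ is the free monoid on letters $1,\dots,n$ with identity $\varnothing$, $e_\varnothing=\Omega$, and $e_{\mu_1\cdots\mu_m}=e_{\mu_1}\otimes\cdots\otimes e_{\mu_m}$. The left creation operators are the isometries $S_ie_\mu=e_{i\mu}$, $1\le i\le n$. Scalar odometer map: for $\xi\in\mathcal F_n^2$, the scalar odometer map with symbol $\xi$ is the bounded operator $W_\xi\in\mathcal B(\mathcal F_n^2)$ determined by $W_\xi\Omega=\xi$ and, for a nonempty word $\mu=\mu_1\cdots\mu_m$: if $\mu\ne n^m$ (not all letters equal $n$) and $r=\min\{j:\mu_j\neq n\}$, then $W_\xi e_\mu=e_1^{\otimes(r-1)}\otimes e_{\mu_r+1}\otimes e_{\mu_{r+1}}\otimes\cdots\otimes e_{\mu_m}$; if $\mu=n^m$, then $W_\xi e_{n^m}=e_1^{\otimes m}\otimes\xi$. The source asserts, citing earlier work, that for every $\xi\in\mathcal F_n^2$ this prescription defines an element of $\mathcal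 B(\mathcal F_n^2)$, with $\|\xi\|\le\|W_\xi\|\le 1+\|\xi\|$. $C^*(\cdot)$ denotes the generated $C^*$-subalgebra of $\mathcal B(\mathcal F_n^2)$, and $\mathcal K(\mathcal F_n^2)$ the $C^*$-algebra of compact operators on $\mathcal F_n^2$.
   Formalization: The claim is made only for symbols ξ whose odometer prescription defines a bounded operator W_ξ; this fails for some ξ, e.g. ξ = Σ e_{1^k}/(k+1), since Σ z^k/(k+1) is unbounded on the disc, and then A_ξ is undefined. *)

theory Defs
  imports "HOL-Analysis.Analysis"
begin

section \<open>The complex Hilbert space of square-summable families\<close>

typedef 'a ell2 = "{f :: 'a \<Rightarrow> complex. (\<lambda>i. (cmod (f i))\<^sup>2) summable_on UNIV}"
  morphisms coord Abs_ell2
proof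
  show "(\<lambda>_. 0) \<in> {f :: 'a \<Rightarrow> complex. (\<lambda>i. (cmod (f i))\<^sup>2) summable_on UNIV}" by simp
qed

setup_lifting type_definition_ell2

lemma summable_square_coord: "(\<lambda>i. (cmod (coord x i))\<^sup>2) summable_on UNIV"
  using coord[of x] by simp

lemma ell2_eqI: "(\<And>i. coord x i = coord y i) \<Longrightarrow> x = y"
  by (metis coord_inject ext)

lemma summable_square_mult:
  fixes f g :: "'a \<Rightarrow> complex"
  assumes "(\<lambda>i. (cmod (f i))\<^sup>2) summable_on A" "(\<lambda>i. (cmod (g i))\<^sup>2) summable_on A"
  shows "(\<lambda>i. f i * cnj (g i)) summable_on A"
proof -
  have "(\<lambda>i. (cmod (f i))\<^sup>2 + (cmod (g i))\<^sup>2) summable_on A"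
    using assms by (rule summable_on_add)
  moreover have "cmod (f i * cnj (g i)) \<le> (cmod (f i))\<^sup>2 + (cmod (g i))\<^sup>2" for i
  proof -
    have "2 * cmod (f i) * cmod (g i) \<le> (cmod (f i))\<^sup>2 + (cmod (g i))\<^sup>2"
      by (rule sum_squares_bound)
    moreover have "0 \<le> cmod (f i) * cmod (g i)" by simp
    ultimately show ?thesis unfolding norm_mult complex_mod_cnj by linarith
  qed
  ultimately have "(\<lambda>i. cmod (f i * cnj (g i))) summable_on A"
    by (rule summable_on_comparison_test) auto
  then show ?thesis
    by (rule abs_summable_summable)
qed

lemma summable_square_add:
  fixes f g :: "'a \<Rightarrow> complex"
  assumes "(\<lambda>i. (cmod (f i))\<^sup>2) summable_on A" "(\<lambda>i. (cmod (g i))\<^sup>2) summable_on A"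
  shows "(\<lambda>i. (cmod (f i + g i))\<^sup>2) summable_on A"
proof -
  have "(\<lambda>i. 2 * (cmod (f i))\<^sup>2 + 2 * (cmod (g i))\<^sup>2) summable_on A"
    using assms by (intro summable_on_add summable_on_cmult_right)
  moreover have "(cmod (f i + g i))\<^sup>2 \<le> 2 * (cmod (f i))\<^sup>2 + 2 * (cmod (g i))\<^sup>2" for i
  proof -
    have "(cmod (f i + g i))\<^sup>2 \<le> (cmod (f i) + cmod (g i))\<^sup>2"
      by (intro power_mono norm_triangle_ineq) simp
    moreover have "2 * cmod (f i) * cmod (g i) \<le> (cmod (f i))\<^sup>2 + (cmod (g i))\<^sup>2"
      by (rule sum_squares_bound)
    ultimately show ?thesis by (simp add: power2_sum)
  qed
  ultimately show ?thesis
    by (rule summable_on_comparison_test) auto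
qed

lemma summable_square_cmult:
  fixes f :: "'a \<Rightarrow> complex"
  assumes "(\<lambda>i. (cmod (f i))\<^sup>2) summable_on A"
  shows "(\<lambda>i. (cmod (c * f i))\<^sup>2) summable_on A"
  using summable_on_cmult_right[OF assms, of "(cmod c)\<^sup>2"] by (simp add: norm_mult power_mult_distrib)

lift_definition scaleC :: "complex \<Rightarrow> 'a ell2 \<Rightarrow> 'a ell2" is "\<lambda>c f i. c * f i"
  by (simp add: summable_square_cmult)

text \<open>Linear in the first argument.\<close>

definition cinner :: "'a ell2 \<Rightarrow> 'a ell2 \<Rightarrow> complex" where
  "cinner x y = (\<Sum>\<^sub>\<infinity>i. coord x i * cnj (coord y i))"

lemma summable_cinner: "(\<lambda>i. coord x i * cnj (coord y i)) summable_on UNIV"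
  by (intro summable_square_mult summable_square_coord)

instantiation ell2 :: (type) real_inner
begin

lift_definition zero_ell2 :: "'a ell2" is "\<lambda>_. 0" by simp

lift_definition plus_ell2 :: "'a ell2 \<Rightarrow> 'a ell2 \<Rightarrow> 'a ell2" is "\<lambda>f g i. f i + g i"
  by (simp add: summable_square_add)

lift_definition uminus_ell2 :: "'a ell2 \<Rightarrow> 'a ell2" is "\<lambda>f i. - f i" by simp

lift_definition minus_ell2 :: "'a ell2 \<Rightarrow> 'a ell2 \<Rightarrow> 'a ell2" is "\<lambda>f g i. f i - g i"
  using summable_square_add[where g = "\<lambda>i. - g i" for g] by fastforce

definition scaleR_ell2 :: "real \<Rightarrow> 'a ell2 \<Rightarrow> 'a ell2" where
  "scaleR_ell2 r x = scaleC (complex_of_real r) x"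

definition inner_ell2 :: "'a ell2 \<Rightarrow> 'a ell2 \<Rightarrow> real" where
  "inner_ell2 x y = Re (cinner x y)"

definition norm_ell2 :: "'a ell2 \<Rightarrow> real" where
  "norm_ell2 x = sqrt (inner x x)"

definition sgn_ell2 :: "'a ell2 \<Rightarrow> 'a ell2" where
  "sgn_ell2 x = inverse (norm x) *\<^sub>R x"

definition dist_ell2 :: "'a ell2 \<Rightarrow> 'a ell2 \<Rightarrow> real" where
  "dist_ell2 x y = norm (x - y)"

definition uniformity_ell2 :: "('a ell2 \<times> 'a ell2) filter" where
  "uniformity_ell2 = (INF e\<in>{0<..}. principal {(x, y). dist x y < e})"

definition open_ell2 :: "'a ell2 set \<Rightarrow> bool" where
  "open_ell2 U \<longleftrightarrow> (\<forall>x\<in>U. \<forall>\<^sub>F (x', y) in uniformity. x' = x \<longrightarrow> y \<in> U)"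

lemma cinner_self: "cinner x x = complex_of_real (\<Sum>\<^sub>\<infinity>i. (cmod (coord x i))\<^sup>2)"
proof -
  have "coord x i * cnj (coord x i) = complex_of_real ((cmod (coord x i))\<^sup>2)" for i
    by (simp only: complex_norm_square)
  then have "cinner x x = (\<Sum>\<^sub>\<infinity>i. complex_of_real ((cmod (coord x i))\<^sup>2))"
    by (simp only: cinner_def)
  also have "\<dots> = complex_of_real (\<Sum>\<^sub>\<infinity>i. (cmod (coord x i))\<^sup>2)"
    by (intro infsumI has_sum_bounded_linear[OF bounded_linear_of_real] has_sum_infsum
        summable_square_coord)
  finally show ?thesis .
qed

lemma cinner_add_left: "cinner (x + y) z = cinner x z + cinner y z"
proof -
  have "cinner (x + y) z
      = (\<Sum>\<^sub>\<infinity>i. coord x i * cnj (coord z i) + coord y i * cnj (coord z i))"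
    by (simp add: cinner_def plus_ell2.rep_eq distrib_right)
  then show ?thesis
    by (simp add: cinner_def infsum_add summable_cinner)
qed

lemma cinner_scaleC_left: "cinner (scaleC c x) y = c * cinner x y"
  by (simp add: cinner_def scaleC.rep_eq mult.assoc infsum_cmult_right')

lemma cinner_commute: "cinner x y = cnj (cinner y x)"
  by (simp add: cinner_def mult.commute flip: infsum_cnj)

instance
proof
  fix x y z :: "'a ell2" and a b r :: real
  show "x + y + z = x + (y + z)" by (rule ell2_eqI) (simp add: plus_ell2.rep_eq)
  show "x + y = y + x" by (rule ell2_eqI) (simp add: plus_ell2.rep_eq)
  show "0 + x = x" by (rule ell2_eqI) (simp add: plus_ell2.rep_eq zero_ell2.rep_eq)
  show "- x + x = 0"
    by (rule ell2_eqI) (simp add: plus_ell2.rep_eq uminus_ell2.rep_eq zero_ell2.rep_eq)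
  show "x - y = x + - y" 
    by (rule ell2_eqI) (simp add: plus_ell2.rep_eq uminus_ell2.rep_eq minus_ell2.rep_eq)
  show "a *\<^sub>R (x + y) = a *\<^sub>R x + a *\<^sub>R y"
    by (rule ell2_eqI) (simp add: scaleR_ell2_def scaleC.rep_eq plus_ell2.rep_eq distrib_left)
  show "(a + b) *\<^sub>R x = a *\<^sub>R x + b *\<^sub>R x"
    by (rule ell2_eqI) (simp add: scaleR_ell2_def scaleC.rep_eq plus_ell2.rep_eq distrib_right)
  show "a *\<^sub>R b *\<^sub>R x = (a * b) *\<^sub>R x"
    by (rule ell2_eqI) (simp add: scaleR_ell2_def scaleC.rep_eq)
  show "1 *\<^sub>R x = x"
    by (rule ell2_eqI) (simp add: scaleR_ell2_def scaleC.rep_eq)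
  show "sgn x = inverse (norm x) *\<^sub>R x" by (rule sgn_ell2_def)
  show "dist x y = norm (x - y)" by (rule dist_ell2_def)
  show "uniformity = (INF e\<in>{0<..}. principal {(x :: 'a ell2, y). dist x y < e})"
    by (rule uniformity_ell2_def)
  show "norm x = sqrt (inner x x)" by (rule norm_ell2_def)
  show "inner x y = inner y x"
    unfolding inner_ell2_def by (subst cinner_commute) simp
  show "inner (x + y) z = inner x z + inner y z"
    by (simp add: inner_ell2_def cinner_add_left)
  show "inner (r *\<^sub>R x) y = r * inner x y"
    by (simp add: inner_ell2_def scaleR_ell2_def cinner_scaleC_left)
  show "0 \<le> inner x x"
    by (simp add: inner_ell2_def cinner_self infsum_nonneg)
  show "inner x x = 0 \<longleftrightarrow> x = 0"
  proof
    assume "inner x x = 0"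
    then have "(\<Sum>\<^sub>\<infinity>i. (cmod (coord x i))\<^sup>2) = 0"
      by (simp add: inner_ell2_def cinner_self)
    then have "(cmod (coord x i))\<^sup>2 = 0" for i
      using infsum_0_simp
      by (intro nonneg_infsum_le_0D[OF _ summable_square_coord]) auto
    then show "x = 0" by (intro ell2_eqI) (simp add: zero_ell2.rep_eq)
  next
    assume "x = 0"
    then show "inner x x = 0"
      by (simp add: inner_ell2_def cinner_self zero_ell2.rep_eq)
  qed
next
  fix U :: "'a ell2 set"
  show "open U \<longleftrightarrow> (\<forall>x\<in>U. \<forall>\<^sub>F (x', y) in uniformity. x' = x \<longrightarrow> y \<in> U)"
    by (rule open_ell2_def)
qed

end


lemmas coord_simps [simp] =
  zero_ell2.rep_eq plus_ell2.rep_eq uminus_ell2.rep_eq minus_ell2.rep_eq scaleC.rep_eq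

lemma norm_ell2_squared: "(norm x)\<^sup>2 = (\<Sum>\<^sub>\<infinity>i. (cmod (coord x i))\<^sup>2)"
  by (simp add: norm_ell2_def inner_ell2_def cinner_self infsum_nonneg)

lemma scaleC_add_right: "scaleC c (x + y) = scaleC c x + scaleC c y"
  by (rule ell2_eqI) (simp add: distrib_left)

lemma scaleC_scaleR: "scaleC c (r *\<^sub>R x) = r *\<^sub>R scaleC c x"
  by (rule ell2_eqI) (simp add: scaleR_ell2_def)

lemma norm_scaleC: "norm (scaleC c x) = cmod c * norm x"
proof (rule power2_eq_imp_eq)
  show "(norm (scaleC c x))\<^sup>2 = (cmod c * norm x)\<^sup>2"
    by (simp add: norm_ell2_squared power_mult_distrib norm_mult infsum_cmult_right')
qed simp_all

lemma cinner_add_right: "cinner x (y + z) = cinner x y + cinner x z"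
  by (metis cinner_add_left cinner_commute complex_cnj_add)

lemma cinner_scaleC_right: "cinner x (scaleC c y) = cnj c * cinner x y"
  by (metis cinner_scaleC_left cinner_commute complex_cnj_mult)

lemma norm_cinner_le: "cmod (cinner x y) \<le> norm x * norm y"
proof (cases "cinner x y = 0")
  case False
  define u where "u = cnj (sgn (cinner x y))"
  have u: "cmod u = 1" using False by (simp add: u_def norm_sgn)
  have "cinner x y * cnj (cinner x y) = complex_of_real (cmod (cinner x y)) ^ 2"
    using complex_norm_square[of "cinner x y"] by simp
  then have "u * cinner x y = complex_of_real (cmod (cinner x y))"
    using False by (simp add: u_def sgn_eq field_simps power2_eq_square)
  then have "cmod (cinner x y) = inner (scaleC u x) y"
    by (simp add: inner_ell2_def cinner_scaleC_left)
  also have "\<dots> \<le> norm (scaleC u x) * norm y" by (rule norm_cauchy_schwarz)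
  finally show ?thesis by (simp add: norm_scaleC u)
qed simp

lift_definition ket :: "'a \<Rightarrow> 'a ell2" is "\<lambda>i j. if j = i then 1 else 0"
proof -
  fix i :: 'a
  have "(\<lambda>j. (cmod (if j = i then 1 else 0))\<^sup>2) summable_on {i}" by simp
  then show "(\<lambda>j. (cmod (if j = i then 1 else 0))\<^sup>2) summable_on UNIV"
    by (rule summable_on_cong_neutral[THEN iffD1, rotated -1]) auto
qed

lemma cinner_ket: "cinner x (ket i) = coord x i"
proof -
  have "cinner x (ket i) = (\<Sum>\<^sub>\<infinity>j\<in>{i}. coord x j * cnj (coord (ket i) j))"
    unfolding cinner_def by (rule infsum_cong_neutral) (auto simp: ket.rep_eq)
  then show ?thesis by (simp add: ket.rep_eq)
qed

lemma ket_cinner: "cinner (ket i) x = cnj (coord x i)"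
  by (subst cinner_commute) (simp add: cinner_ket)

lemma ell2_expansion: "((\<lambda>i. scaleC (coord x i) (ket i)) has_sum x) UNIV"
proof -
  let ?p = "\<lambda>F. \<Sum>i\<in>F. scaleC (coord x i) (ket i)"
  have cp: "coord (?p F) j = (if j \<in> F then coord x j else 0)" if "finite F" for F j
    using that by (induction F rule: finite_induct) (auto simp: ket.rep_eq)
  have nrm: "(norm (x - ?p F))\<^sup>2
      = (\<Sum>\<^sub>\<infinity>i. (cmod (coord x i))\<^sup>2) - (\<Sum>i\<in>F. (cmod (coord x i))\<^sup>2)" if F: "finite F" for F
  proof -
    have "(norm (x - ?p F))\<^sup>2 = (\<Sum>\<^sub>\<infinity>i\<in>-F. (cmod (coord x i))\<^sup>2)"
      unfolding norm_ell2_squared by (rule infsum_cong_neutral) (auto simp: cp[OF F])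
    also have "\<dots> = (\<Sum>\<^sub>\<infinity>i. (cmod (coord x i))\<^sup>2) - (\<Sum>\<^sub>\<infinity>i\<in>F. (cmod (coord x i))\<^sup>2)"
      unfolding Compl_eq_Diff_UNIV
      by (rule infsum_Diff) (auto simp: summable_square_coord F)
    finally show ?thesis by (simp add: F)
  qed
  have "((\<lambda>F. \<Sum>i\<in>F. (cmod (coord x i))\<^sup>2) \<longlongrightarrow> (\<Sum>\<^sub>\<infinity>i. (cmod (coord x i))\<^sup>2)) (finite_subsets_at_top UNIV)"
    using has_sum_infsum[OF summable_square_coord[of x]] by (simp add: has_sum_def)
  then have "((\<lambda>F. sqrt ((\<Sum>\<^sub>\<infinity>i. (cmod (coord x i))\<^sup>2) - (\<Sum>i\<in>F. (cmod (coord x i))\<^sup>2)))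
      \<longlongrightarrow> sqrt ((\<Sum>\<^sub>\<infinity>i. (cmod (coord x i))\<^sup>2) - (\<Sum>\<^sub>\<infinity>i. (cmod (coord x i))\<^sup>2)))
      (finite_subsets_at_top UNIV)"
    by (intro tendsto_intros)
  moreover have "\<forall>\<^sub>F F in finite_subsets_at_top UNIV.
      sqrt ((\<Sum>\<^sub>\<infinity>i. (cmod (coord x i))\<^sup>2) - (\<Sum>i\<in>F. (cmod (coord x i))\<^sup>2)) = norm (?p F - x)"
    by (rule eventually_finite_subsets_at_top_weakI)
       (simp add: nrm[symmetric] norm_minus_commute)
  ultimately have "((\<lambda>F. norm (?p F - x)) \<longlongrightarrow> 0) (finite_subsets_at_top UNIV)"
    using tendsto_cong by fastforce
  then show ?thesis
    unfolding has_sum_def using Lim_null tendsto_norm_zero_iff by blast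
qed

section \<open>Bounded operators and \<open>C\<^sup>*\<close>-algebras\<close>

text \<open>The type of continuous linear maps only records real linearity; complex linearity is
  imposed here.\<close>

definition bounded_operators :: "('a ell2 \<Rightarrow>\<^sub>L 'a ell2) set" where
  "bounded_operators = {T. \<forall>c x. blinfun_apply T (scaleC c x) = scaleC c (blinfun_apply T x)}"

definition adj :: "('a ell2 \<Rightarrow>\<^sub>L 'a ell2) \<Rightarrow> ('a ell2 \<Rightarrow>\<^sub>L 'a ell2)" where
  "adj T = (THE T'. \<forall>x y. cinner (blinfun_apply T x) y = cinner x (blinfun_apply T' y))"

lift_definition scalar_operator :: "complex \<Rightarrow> 'a ell2 \<Rightarrow>\<^sub>L 'a ell2" is scaleC
proof -
  fix c :: complex
  show "bounded_linear (scaleC c :: 'a ell2 \<Rightarrow> 'a ell2)"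
    by (rule bounded_linear_intro[where K = "cmod c"])
       (simp_all add: scaleC_add_right scaleC_scaleR norm_scaleC mult.commute)
qed

definition cstar_subalgebra :: "('a ell2 \<Rightarrow>\<^sub>L 'a ell2) set \<Rightarrow> bool" where
  "cstar_subalgebra A \<longleftrightarrow>
     A \<subseteq> bounded_operators \<and> 0 \<in> A \<and>
     (\<forall>S\<in>A. \<forall>T\<in>A. S + T \<in> A) \<and>
     (\<forall>c. \<forall>T\<in>A. scalar_operator c o\<^sub>L T \<in> A) \<and>
     (\<forall>S\<in>A. \<forall>T\<in>A. S o\<^sub>L T \<in> A) \<and>
     (\<forall>T\<in>A. adj T \<in> A) \<and>
     closed A"

definition cstar_generated :: "('a ell2 \<Rightarrow>\<^sub>L 'a ell2) set \<Rightarrow> ('a ell2 \<Rightarrow>\<^sub>L 'a ell2) set" where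
  "cstar_generated G = \<Inter>{A. cstar_subalgebra A \<and> G \<subseteq> A}"

definition compact_operators :: "('a ell2 \<Rightarrow>\<^sub>L 'a ell2) set" where
  "compact_operators = {T \<in> bounded_operators. compact (closure (blinfun_apply T ` cball 0 1))}"

lemma bounded_operators_scaleC:
  "T \<in> bounded_operators \<Longrightarrow> blinfun_apply T (scaleC c x) = scaleC c (blinfun_apply T x)"
  by (simp add: bounded_operators_def)

lemma adjoint_exists:
  fixes T :: "'a ell2 \<Rightarrow>\<^sub>L 'a ell2"
  assumes T: "T \<in> bounded_operators"
  obtains T' where "T' \<in> bounded_operators"
    "\<And>x y. cinner (blinfun_apply T x) y = cinner x (blinfun_apply T' y)"
proof -
  define g where "g y i = cinner y (blinfun_apply T (ket i))" for y i
  have bound: "(\<Sum>i\<in>F. (cmod (g y i))\<^sup>2) \<le> (norm T * norm y)\<^sup>2" if F: "finite F" for F y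
  proof -
    define v where "v = (\<Sum>i\<in>F. scaleC (g y i) (ket i))"
    let ?s = "\<Sum>i\<in>F. (cmod (g y i))\<^sup>2"
    have cv: "coord v j = (if j \<in> F then g y j else 0)" for j
      unfolding v_def using F by (induction F rule: finite_induct) (auto simp: ket.rep_eq)
    have nv: "(norm v)\<^sup>2 = ?s"
    proof -
      have "(norm v)\<^sup>2 = (\<Sum>\<^sub>\<infinity>i\<in>F. (cmod (g y i))\<^sup>2)"
        unfolding norm_ell2_squared by (rule infsum_cong_neutral) (auto simp: cv)
      then show ?thesis by (simp add: F)
    qed
    have "cinner (blinfun_apply T v) y = (\<Sum>i\<in>F. g y i * cinner (blinfun_apply T (ket i)) y)"
      unfolding v_def using F
    proof (induction F rule: finite_induct)
      case empty
      show ?case by (simp add: cinner_def)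
    next
      case (insert i F)
      then show ?case
        by (simp add: blinfun.add_right cinner_add_left cinner_scaleC_left
            bounded_operators_scaleC[OF T])
    qed
    also have "\<dots> = complex_of_real ?s"
      unfolding of_real_sum
    proof (rule sum.cong[OF refl])
      fix i
      have "cinner (blinfun_apply T (ket i)) y = cnj (g y i)"
        unfolding g_def by (rule cinner_commute)
      then show "g y i * cinner (blinfun_apply T (ket i)) y = complex_of_real ((cmod (g y i))\<^sup>2)"
        by (simp only: complex_norm_square)
    qed
    finally have "cmod (cinner (blinfun_apply T v) y) = ?s"
      by (simp only: norm_of_real) (simp add: sum_nonneg)
    then have "?s \<le> norm (blinfun_apply T v) * norm y"
      using norm_cinner_le by metis
    also have "\<dots> \<le> norm T * norm v * norm y"
      by (intro mult_right_mono norm_blinfun) simp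
    finally have *: "norm v * norm v \<le> (norm T * norm y) * norm v"
      by (simp only: nv[symmetric]) (simp add: power2_eq_square mult_ac)
    then have "norm v \<le> norm T * norm y"
      by (cases "norm v = 0") (auto simp: mult_le_cancel_right)
    then show ?thesis
      using power_mono[of "norm v" _ 2] by (simp add: nv[symmetric])
  qed
  have sq: "(\<lambda>i. (cmod (g y i))\<^sup>2) summable_on UNIV" for y
    by (rule nonneg_bdd_above_summable_on) (auto intro!: bdd_aboveI2 bound)
  define h where "h y = Abs_ell2 (g y)" for y
  have ch: "coord (h y) i = g y i" for y i
    unfolding h_def using sq by (simp add: Abs_ell2_inverse)
  have nh: "norm (h y) \<le> norm y * norm T" for y
  proof (rule power2_le_imp_le)
    show "(norm (h y))\<^sup>2 \<le> (norm y * norm T)\<^sup>2"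
      unfolding norm_ell2_squared ch
      by (rule infsum_le_finite_sums[OF sq]) (use bound in \<open>auto simp: mult.commute\<close>)
  qed simp
  have "bounded_linear h"
  proof (rule bounded_linear_intro[where K = "norm T"])
    show "h (x + y) = h x + h y" for x y
      by (rule ell2_eqI) (simp add: ch g_def cinner_add_left)
    show "h (r *\<^sub>R x) = r *\<^sub>R h x" for r x
      by (rule ell2_eqI) (simp add: ch g_def cinner_scaleC_left scaleR_ell2_def)
  qed (rule nh)
  then have app: "blinfun_apply (Blinfun h) = h" by (rule bounded_linear_Blinfun_apply)
  have B: "Blinfun h \<in> bounded_operators"
    unfolding bounded_operators_def
    by (auto intro!: ell2_eqI simp: app ch g_def cinner_scaleC_left)
  moreover have "cinner (blinfun_apply T x) y = cinner x (blinfun_apply (Blinfun h) y)" for x y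
  proof -
    have bl: "bounded_linear (\<lambda>x. cinner x z)" for z :: "'a ell2"
      by (rule bounded_linear_intro[where K = "norm z"])
         (simp_all add: cinner_add_left cinner_scaleC_left scaleR_ell2_def norm_cinner_le
           scaleR_conv_of_real)
    have 1: "((\<lambda>i. cinner (scaleC (coord x i) (ket i)) (h y)) has_sum cinner x (h y)) UNIV"
      using has_sum_bounded_linear[OF bl ell2_expansion] by (simp add: o_def)
    have "bounded_linear (\<lambda>x. cinner (blinfun_apply T x) y)"
      by (rule bounded_linear_compose[OF bl blinfun.bounded_linear_right])
    from has_sum_bounded_linear[OF this ell2_expansion]
    have 2: "((\<lambda>i. cinner (blinfun_apply T (scaleC (coord x i) (ket i))) y)
        has_sum cinner (blinfun_apply T x) y) UNIV"
      by (simp add: o_def)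
    have "cinner (blinfun_apply T (ket i)) y = cinner (ket i) (h y)" for i
      by (simp add: ket_cinner ch g_def flip: cinner_commute)
    then have "(\<lambda>i. cinner (blinfun_apply T (scaleC (coord x i) (ket i))) y)
        = (\<lambda>i. cinner (scaleC (coord x i) (ket i)) (h y))"
      by (simp add: bounded_operators_scaleC[OF T] cinner_scaleC_left)
    then show ?thesis
      unfolding app using 1 2 has_sum_unique by metis
  qed
  ultimately show ?thesis by (rule that)
qed

lemma cinner_left_eqI: "(\<And>x. cinner x y = cinner x z) \<Longrightarrow> y = z"
  by (rule ell2_eqI) (metis ket_cinner complex_cnj_cancel_iff)

lemma
  assumes "T \<in> bounded_operators"
  shows adj_in_bounded_operators: "adj T \<in> bounded_operators"
    and cinner_adj: "cinner (blinfun_apply T x) y = cinner x (blinfun_apply (adj T) y)"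
proof -
  obtain T' where T': "T' \<in> bounded_operators"
      "\<And>x y. cinner (blinfun_apply T x) y = cinner x (blinfun_apply T' y)"
    using adjoint_exists[OF assms] by blast
  have "adj T = T'"
    unfolding adj_def
  proof (rule the_equality)
    fix U assume U: "\<forall>x y. cinner (blinfun_apply T x) y = cinner x (blinfun_apply U y)"
    show "U = T'"
      by (intro blinfun_eqI cinner_left_eqI) (metis U T'(2))
  qed (simp add: T'(2))
  then show "adj T \<in> bounded_operators"
    "cinner (blinfun_apply T x) y = cinner x (blinfun_apply (adj T) y)"
    using T' by simp_all
qed

lemma bounded_operator_eqI:
  assumes "S \<in> bounded_operators" "T \<in> bounded_operators"
    and "\<And>i. blinfun_apply S (ket i) = blinfun_apply T (ket i)"
  shows "S = T"
proof (rule blinfun_eqI)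
  fix x
  have "((\<lambda>i. scaleC (coord x i) (blinfun_apply U (ket i))) has_sum blinfun_apply U x) UNIV"
    if "U \<in> bounded_operators" for U :: "'a ell2 \<Rightarrow>\<^sub>L 'a ell2"
    using has_sum_bounded_linear[OF blinfun.bounded_linear_right ell2_expansion, of U x]
    by (simp add: o_def bounded_operators_scaleC[OF that])
  from this[OF assms(1)] this[OF assms(2)]
  show "blinfun_apply S x = blinfun_apply T x"
    unfolding assms(3) by (rule has_sum_unique)
qed

lemma cstar_subalgebra_bounded_operators: "cstar_subalgebra bounded_operators"
proof -
  have "closed {T :: 'a ell2 \<Rightarrow>\<^sub>L 'a ell2.
      blinfun_apply T (scaleC c x) = blinfun_apply (scalar_operator c) (blinfun_apply T x)}" for c x
    by (intro closed_Collect_eq continuous_intros)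
  then have "closed (\<Inter>c. \<Inter>x. {T :: 'a ell2 \<Rightarrow>\<^sub>L 'a ell2.
      blinfun_apply T (scaleC c x) = blinfun_apply (scalar_operator c) (blinfun_apply T x)})"
    by (intro closed_INT ballI)
  moreover have "(\<Inter>c. \<Inter>x. {T :: 'a ell2 \<Rightarrow>\<^sub>L 'a ell2.
      blinfun_apply T (scaleC c x) = blinfun_apply (scalar_operator c) (blinfun_apply T x)})
    = bounded_operators"
    by (auto simp: bounded_operators_def scalar_operator.rep_eq)
  ultimately have "closed (bounded_operators :: ('a ell2 \<Rightarrow>\<^sub>L 'a ell2) set)" by simp
  moreover have "scaleC c (scaleC d x) = scaleC d (scaleC c x)" for c d and x :: "'a ell2"
    by (rule ell2_eqI) simp
  moreover have "scaleC c 0 = 0" for c :: complex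
    by (rule ell2_eqI) simp
  ultimately show ?thesis
    unfolding cstar_subalgebra_def
    by (auto simp: adj_in_bounded_operators)
       (auto simp: bounded_operators_def blinfun.add_left scaleC_add_right scalar_operator.rep_eq)
qed

text \<open>The intersection defining \<open>cstar_generated\<close> is therefore over a nonempty
  family whenever the generators lie in \<open>bounded_operators\<close>.\<close>

section \<open>The full Fock space and the scalar odometer\<close>

text \<open>Words over an alphabet \<open>'n\<close> index the canonical orthonormal basis of the full Fock space,
  \<open>ket \<mu>\<close> being \<open>e\<^sub>\<mu>\<close> and \<open>ket []\<close> the vacuum. The alphabet is a finite linear order; its elements
  in increasing order are the letters \<open>1, \<dots>, n\<close>.\<close>

type_synonym 'n fock = "'n list ell2"

definition first_letter :: "'n::{finite,linorder}" where
  "first_letter = Min UNIV"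

definition last_letter :: "'n::{finite,linorder}" where
  "last_letter = Max UNIV"

definition next_letter :: "'n::{finite,linorder} \<Rightarrow> 'n" where
  "next_letter i = Min {j. i < j}"

text \<open>\<open>word_tensor \<alpha> \<xi>\<close> is \<open>e\<^sub>\<alpha> \<otimes> \<xi>\<close>.\<close>

lift_definition word_tensor :: "'n list \<Rightarrow> 'n fock \<Rightarrow> 'n fock" is
  "\<lambda>\<alpha> f \<mu>. if take (length \<alpha>) \<mu> = \<alpha> then f (drop (length \<alpha>) \<mu>) else 0"
proof -
  fix \<alpha> :: "'n list" and f :: "'n list \<Rightarrow> complex"
  let ?g = "\<lambda>\<mu>. (cmod (if take (length \<alpha>) \<mu> = \<alpha> then f (drop (length \<alpha>) \<mu>) else 0))\<^sup>2"
  assume "(\<lambda>\<mu>. (cmod (f \<mu>))\<^sup>2) summable_on UNIV"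
  then have "(?g \<circ> (@) \<alpha>) summable_on UNIV" by (simp add: o_def)
  then have "?g summable_on range ((@) \<alpha>)"
    by (subst summable_on_reindex) (auto simp: inj_on_def)
  then show "?g summable_on UNIV"
    by (rule summable_on_cong_neutral[THEN iffD1, rotated -1])
       (auto simp: image_iff, metis append_take_drop_id)
qed

lemma word_tensor_ket: "word_tensor \<alpha> (ket \<mu>) = ket (\<alpha> @ \<mu>)"
proof (rule ell2_eqI)
  fix \<nu>
  have "take (length \<alpha>) \<nu> = \<alpha> \<and> drop (length \<alpha>) \<nu> = \<mu> \<longleftrightarrow> \<nu> = \<alpha> @ \<mu>"
    by (metis append_eq_conv_conj append_take_drop_id)
  then show "coord (word_tensor \<alpha> (ket \<mu>)) \<nu> = coord (ket (\<alpha> @ \<mu>)) \<nu>"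
    by (auto simp: word_tensor.rep_eq ket.rep_eq)
qed

lemma norm_word_tensor: "norm (word_tensor \<alpha> \<xi>) = norm \<xi>"
proof (rule power2_eq_imp_eq)
  have "(norm (word_tensor \<alpha> \<xi>))\<^sup>2
      = (\<Sum>\<^sub>\<infinity>\<mu>\<in>range ((@) \<alpha>). (cmod (coord (word_tensor \<alpha> \<xi>) \<mu>))\<^sup>2)"
    unfolding norm_ell2_squared
    by (rule infsum_cong_neutral)
       (auto simp: word_tensor.rep_eq image_iff, metis append_take_drop_id)
  also have "\<dots> = (norm \<xi>)\<^sup>2"
    by (subst infsum_reindex) (auto simp: inj_on_def o_def word_tensor.rep_eq norm_ell2_squared)
  finally show "(norm (word_tensor \<alpha> \<xi>))\<^sup>2 = (norm \<xi>)\<^sup>2" .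
qed simp_all

lift_definition left_creation :: "'n \<Rightarrow> 'n fock \<Rightarrow>\<^sub>L 'n fock" is "\<lambda>i. word_tensor [i]"
  by (rule bounded_linear_intro[where K = 1])
     (auto intro!: ell2_eqI simp: norm_word_tensor word_tensor.rep_eq scaleR_ell2_def)

lemma left_creation_ket: "blinfun_apply (left_creation i) (ket \<mu>) = ket (i # \<mu>)"
  by (simp add: left_creation.rep_eq word_tensor_ket)

lemma left_creation_in_bounded_operators: "left_creation i \<in> bounded_operators"
  by (auto intro!: ell2_eqI
      simp: bounded_operators_def left_creation.rep_eq word_tensor.rep_eq)

text \<open>Positions in a word are counted from \<open>0\<close>, so \<open>r\<close> below is one less than the usual
  1-based index of the first letter different from \<open>n\<close>.\<close>

definition odometer_word :: "'n::{finite,linorder} list \<Rightarrow> 'n list" where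
  "odometer_word \<mu> =
     (let r = (LEAST j. j < length \<mu> \<and> \<mu> ! j \<noteq> last_letter)
      in replicate r first_letter @ next_letter (\<mu> ! r) # drop (Suc r) \<mu>)"

text \<open>The prescription is not bounded for every square-summable symbol: if \<open>\<xi>\<close> has coefficient
  \<open>a\<^sub>k\<close> on the word \<open>1\<^sup>k\<close> and \<open>0\<close> elsewhere, then on the span of the \<open>e\<^sub>\<mu>\<close> with \<open>\<mu> = n\<^sup>m\<close> it acts as
  convolution with \<open>a\<close>, which is bounded only if \<open>\<Sum>a\<^sub>k z\<^sup>k\<close> is bounded on the unit disc. Hence being
  the scalar odometer map with symbol \<open>\<xi>\<close> is a predicate on bounded operators; at most one
  operator satisfies it.\<close>

definition is_scalar_odometer ::
    "'n::{finite,linorder} fock \<Rightarrow> ('n fock \<Rightarrow>\<^sub>L 'n fock) \<Rightarrow> bool" where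
  "is_scalar_odometer \<xi> W \<longleftrightarrow>
     W \<in> bounded_operators \<and>
     blinfun_apply W (ket []) = \<xi> \<and>
     (\<forall>\<mu>. \<mu> \<noteq> [] \<longrightarrow> blinfun_apply W (ket \<mu>) =
        (if \<mu> = replicate (length \<mu>) last_letter
         then word_tensor (replicate (length \<mu>) first_letter) \<xi>
         else ket (odometer_word \<mu>)))"

lemma is_scalar_odometer_unique:
  assumes "is_scalar_odometer \<xi> W" "is_scalar_odometer \<xi> W'"
  shows "W = W'"
proof (rule bounded_operator_eqI)
  show "W \<in> bounded_operators" "W' \<in> bounded_operators"
    using assms by (simp_all add: is_scalar_odometer_def)
  show "blinfun_apply W (ket \<mu>) = blinfun_apply W' (ket \<mu>)" for \<mu>
    using assms by (cases "\<mu> = []") (simp_all add: is_scalar_odometer_def)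
qed

end

(* The creation operators alone suffice: with I = S_i^* S_i, the operator I - sum_i S_i S_i^* is the
   projection onto the vacuum, and multiplying it by creation operators on the left and by their
   adjoints on the right yields all matrix units. A C*-algebra containing all matrix units contains
   every compact operator T, because the partial sums of (sum_i |e_i><e_i|) T converge to T in norm:
   the projections converge strongly to the identity and are contractions, hence they converge
   uniformly on the totally bounded image of the unit ball. *)

theory Submission
  imports Defs
begin

section \<open>Rank-one operators\<close>

lemma scaleC_add_left: "scaleC (c + d) x = scaleC c x + scaleC d x"
  by (rule ell2_eqI) (simp add: distrib_right)

lemma scaleC_scaleC: "scaleC c (scaleC d x) = scaleC (c * d) x"
  by (rule ell2_eqI) simp

lemma scaleC_zero_left [simp]: "scaleC 0 x = 0"
  by (rule ell2_eqI) simp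

lemma scaleC_one [simp]: "scaleC 1 x = x"
  by (rule ell2_eqI) simp

text \<open>\<open>rank_one x y\<close> is the operator \<open>|x\<rangle>\<langle>y|\<close>.\<close>

lift_definition rank_one :: "'a ell2 \<Rightarrow> 'a ell2 \<Rightarrow> 'a ell2 \<Rightarrow>\<^sub>L 'a ell2" is
  "\<lambda>x y z. scaleC (cinner z y) x"
proof -
  fix x y :: "'a ell2"
  show "bounded_linear (\<lambda>z. scaleC (cinner z y) x)"
  proof (rule bounded_linear_intro[where K = "norm y * norm x"])
    fix z z' :: "'a ell2" and r :: real
    show "scaleC (cinner (z + z') y) x = scaleC (cinner z y) x + scaleC (cinner z' y) x"
      by (simp add: cinner_add_left scaleC_add_left)
    show "scaleC (cinner (r *\<^sub>R z) y) x = r *\<^sub>R scaleC (cinner z y) x"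
      by (simp add: scaleR_ell2_def cinner_scaleC_left scaleC_scaleC)
    show "norm (scaleC (cinner z y) x) \<le> norm z * (norm y * norm x)"
      using mult_right_mono[OF norm_cinner_le[of z y], of "norm x"]
      by (simp add: norm_scaleC mult.assoc)
  qed
qed

lemma rank_one_in_bounded_operators: "rank_one x y \<in> bounded_operators"
  by (simp add: bounded_operators_def rank_one.rep_eq cinner_scaleC_left scaleC_scaleC)

lemma rank_one_scaleC_right: "rank_one x (scaleC c y) = scalar_operator (cnj c) o\<^sub>L rank_one x y"
  by (rule blinfun_eqI)
     (simp add: rank_one.rep_eq scalar_operator.rep_eq cinner_scaleC_right scaleC_scaleC)

text \<open>Over the complex numbers the dependence on the second argument is conjugate-linear,
  hence only real linearity is claimed. Boundedness, from Cauchy-Schwarz, carries basis expansions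
  of that argument over to operator-norm convergence.\<close>

lemma bounded_linear_rank_one_right: "bounded_linear (rank_one x)"
proof (rule bounded_linear_intro[where K = "norm x"])
  fix y z :: "'a ell2" and r :: real
  show "rank_one x (y + z) = rank_one x y + rank_one x z"
    by (rule blinfun_eqI)
       (simp add: rank_one.rep_eq blinfun.add_left cinner_add_right scaleC_add_left)
  show "rank_one x (r *\<^sub>R y) = r *\<^sub>R rank_one x y"
    by (rule blinfun_eqI)
       (simp add: rank_one.rep_eq blinfun.scaleR_left scaleR_ell2_def cinner_scaleC_right
         scaleC_scaleC)
  show "norm (rank_one x y) \<le> norm y * norm x"
  proof (rule norm_blinfun_bound)
    show "norm (blinfun_apply (rank_one x y) w) \<le> norm y * norm x * norm w" for w
      using mult_right_mono[OF norm_cinner_le[of w y], of "norm x"]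
      by (simp add: rank_one.rep_eq norm_scaleC mult_ac)
  qed simp
qed

lemma compose_rank_one:
  "T \<in> bounded_operators \<Longrightarrow> T o\<^sub>L rank_one x y = rank_one (blinfun_apply T x) y"
  by (rule blinfun_eqI) (simp add: rank_one.rep_eq bounded_operators_scaleC)

lemma rank_one_compose:
  "T \<in> bounded_operators \<Longrightarrow> rank_one x y o\<^sub>L T = rank_one x (blinfun_apply (adj T) y)"
  by (rule blinfun_eqI) (simp add: rank_one.rep_eq cinner_adj)

lemma adj_adj:
  assumes "T \<in> bounded_operators"
  shows "adj (adj T) = T"
proof (intro blinfun_eqI cinner_left_eqI)
  fix x y
  have "cinner x (blinfun_apply (adj (adj T)) y) = cinner (blinfun_apply (adj T) x) y"
    by (simp add: cinner_adj adj_in_bounded_operators assms)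
  also have "\<dots> = cnj (cinner (blinfun_apply T y) x)"
    by (metis cinner_commute cinner_adj assms)
  also have "\<dots> = cinner x (blinfun_apply T y)"
    by (metis cinner_commute)
  finally show "cinner x (blinfun_apply (adj (adj T)) y) = cinner x (blinfun_apply T y)" .
qed

section \<open>Matrix units generate the compact operators\<close>

text \<open>Truncation to \<open>F\<close> only sets coordinates to zero. Because the bound is the
  same for all \<open>F\<close>, pointwise convergence of the truncations is uniform on totally
  bounded sets.\<close>

lemma norm_partial_expansion_le:
  assumes "finite F"
  shows "norm (\<Sum>i\<in>F. scaleC (coord x i) (ket i)) \<le> norm x"
proof (rule power2_le_imp_le)
  let ?p = "\<Sum>i\<in>F. scaleC (coord x i) (ket i)"
  have "coord ?p j = (if j \<in> F then coord x j else 0)" for j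
    using assms by (induction F rule: finite_induct) (auto simp: ket.rep_eq)
  then show "(norm ?p)\<^sup>2 \<le> (norm x)\<^sup>2"
    unfolding norm_ell2_squared
    by (intro infsum_mono summable_square_coord) auto
qed simp

lemma norm_blinfun_bound_cball:
  assumes "0 \<le> b" and "\<And>x. x \<in> cball 0 1 \<Longrightarrow> norm (blinfun_apply T x) \<le> b"
  shows "norm T \<le> b"
proof (rule norm_blinfun_bound)
  show "norm (blinfun_apply T x) \<le> b * norm x" for x
  proof (cases "x = 0")
    case False
    then have "norm (blinfun_apply T (sgn x)) \<le> b"
      by (intro assms) (simp add: norm_sgn)
    then show ?thesis
      using False by (simp add: sgn_div_norm blinfun.scaleR_right field_simps)
  qed simp
qed fact

text \<open>Each summand is \<open>rank_one (ket i) (ket i)\<close> composed with \<open>T\<close>,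
  so the sum over a finite \<open>F\<close> is \<open>T\<close> followed by truncation to
  \<open>F\<close>.\<close>

lemma compact_operator_has_sum:
  assumes "T \<in> compact_operators"
  shows "((\<lambda>i. rank_one (ket i) (blinfun_apply (adj T) (ket i))) has_sum T) UNIV"
  unfolding has_sum_def
proof (rule tendstoI)
  fix e :: real assume "0 < e"
  \<comment> \<open>Three errors of at most \<open>e / 4\<close> will occur; the fourth quarter
    restores strictness after the non-strict bound on the operator norm.\<close>
  then have e: "0 < e / 4" by simp
  define p where "p F y = (\<Sum>i\<in>F. scaleC (coord y i) (ket i))" for F and y :: "'a ell2"
  have T: "T \<in> bounded_operators"
    and cpt: "compact (closure (blinfun_apply T ` cball 0 1))"
    using assms by (auto simp: compact_operators_def)
  obtain N where N: "finite N" "closure (blinfun_apply T ` cball 0 1) \<subseteq> (\<Union>y\<in>N. ball y (e / 4))"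
    using seq_compact_imp_totally_bounded[OF compact_imp_seq_compact[OF cpt], rule_format, OF e]
    by blast
  have p_diff: "p F (x - y) = p F x - p F y" for F x y
    unfolding p_def sum_subtractf[symmetric]
    by (rule sum.cong[OF refl], rule ell2_eqI) (simp add: left_diff_distrib)
  \<comment> \<open>Finiteness of the net \<open>N\<close> lets all large \<open>F\<close> serve
    every net point at once.\<close>
  have "\<forall>\<^sub>F F in finite_subsets_at_top UNIV. \<forall>y\<in>N. dist (p F y) y < e / 4"
    using tendstoD[OF ell2_expansion[unfolded has_sum_def] e]
    by (intro eventually_ball_finite N(1) ballI) (simp only: p_def)
  moreover have "\<forall>\<^sub>F F in finite_subsets_at_top (UNIV :: 'a set). finite F"
    by (rule eventually_finite_subsets_at_top_weakI)
  ultimately show "\<forall>\<^sub>F F in finite_subsets_at_top UNIV.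
      dist (\<Sum>i\<in>F. rank_one (ket i) (blinfun_apply (adj T) (ket i))) T < e"
  proof eventually_elim
    case (elim F)
    let ?S = "\<Sum>i\<in>F. rank_one (ket i) (blinfun_apply (adj T) (ket i))"
    have S: "blinfun_apply ?S x = p F (blinfun_apply T x)" for x
      by (simp add: p_def blinfun.sum_left rank_one.rep_eq cinner_ket flip: cinner_adj[OF T])
    have "norm (?S - T) \<le> 3 * (e / 4)"
    proof (rule norm_blinfun_bound_cball)
      fix x :: "'a ell2" assume "x \<in> cball 0 1"
      then have "blinfun_apply T x \<in> closure (blinfun_apply T ` cball 0 1)"
        by (rule closure_subset[THEN subsetD, OF imageI])
      then obtain y where y: "y \<in> N" "dist y (blinfun_apply T x) < e / 4"
        using N(2) by (meson UN_E mem_ball subsetD)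
      let ?d = "blinfun_apply T x - y"
      have d: "norm ?d < e / 4"
        using y(2) by (simp add: dist_norm norm_minus_commute)
      \<comment> \<open>Pass through the net point \<open>y\<close>: contractivity controls the
        first term, the choice of \<open>F\<close> the second, the choice of \<open>y\<close> the
        third.\<close>
      have "blinfun_apply (?S - T) x = p F ?d + (p F y - y) - ?d"
        by (simp only: S blinfun.diff_left p_diff) (simp only: algebra_simps)
      also have "norm \<dots> \<le> norm (p F ?d) + norm (p F y - y) + norm ?d"
        by (intro order_trans[OF norm_triangle_ineq4] add_right_mono norm_triangle_ineq)
      also have "\<dots> \<le> 3 * (e / 4)"
      proof -
        have "norm (p F ?d) \<le> norm ?d"
          unfolding p_def by (rule norm_partial_expansion_le[OF elim(2)])
        moreover have "norm (p F y - y) < e / 4"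
          using elim(1) y(1) by (simp add: dist_norm)
        ultimately show ?thesis using d by linarith
      qed
      finally show "norm (blinfun_apply (?S - T) x) \<le> 3 * (e / 4)" .
    qed (use e in simp)
    then show ?case using e by (simp add: dist_norm)
  qed
qed

lemma cstar_subalgebra_sum:
  assumes "cstar_subalgebra A" and "\<And>i. i \<in> I \<Longrightarrow> f i \<in> A"
  shows "sum f I \<in> A"
  using assms(2)
  by (induction I rule: infinite_finite_induct)
     (use assms(1) in \<open>auto simp: cstar_subalgebra_def\<close>)

lemma cstar_subalgebra_has_sum:
  assumes A: "cstar_subalgebra A" and "(f has_sum T) I" and "\<And>i. i \<in> I \<Longrightarrow> f i \<in> A"
  shows "T \<in> A"
proof (rule Lim_in_closed_set)
  show "closed A" using A by (simp add: cstar_subalgebra_def)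
  show "(sum f \<longlongrightarrow> T) (finite_subsets_at_top I)"
    using assms(2) by (simp add: has_sum_def)
  show "\<forall>\<^sub>F F in finite_subsets_at_top I. sum f F \<in> A"
    using assms(3)
    by (intro eventually_finite_subsets_at_top_weakI cstar_subalgebra_sum[OF A]) auto
qed simp

lemma cstar_subalgebra_diff:
  assumes A: "cstar_subalgebra A" and "S \<in> A" "T \<in> A"
  shows "S - T \<in> A"
proof -
  have "S - T = S + (scalar_operator (-1) o\<^sub>L T)"
    by (rule blinfun_eqI, rule ell2_eqI)
       (simp add: blinfun.diff_left blinfun.add_left scalar_operator.rep_eq)
  moreover have "scalar_operator (-1) o\<^sub>L T \<in> A"
    using assms by (simp add: cstar_subalgebra_def)
  ultimately show ?thesis
    using assms by (simp only: cstar_subalgebra_def)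
qed

lemma compact_operators_subset_if_matrix_units:
  fixes A :: "('a ell2 \<Rightarrow>\<^sub>L 'a ell2) set"
  assumes A: "cstar_subalgebra A" and units: "\<And>i j. rank_one (ket i) (ket j) \<in> A"
  shows "compact_operators \<subseteq> A"
proof
  fix T :: "'a ell2 \<Rightarrow>\<^sub>L 'a ell2"
  assume T: "T \<in> compact_operators"
  \<comment> \<open>The vectors \<open>adj T (ket i)\<close> need not be basis vectors, so the
    second argument is first extended from basis vectors to all \<open>y\<close> by expanding
    \<open>y\<close>.\<close>
  have "rank_one (ket i) y \<in> A" for i y
  proof (rule cstar_subalgebra_has_sum[OF A])
    show "((\<lambda>j. rank_one (ket i) (scaleC (coord y j) (ket j))) has_sum rank_one (ket i) y) UNIV"
      using has_sum_bounded_linear[OF bounded_linear_rank_one_right ell2_expansion, of "ket i" y]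
      by (simp add: o_def)
    show "rank_one (ket i) (scaleC (coord y j) (ket j)) \<in> A" for j
      using A units by (simp add: rank_one_scaleC_right cstar_subalgebra_def)
  qed
  then show "T \<in> A"
    by (intro cstar_subalgebra_has_sum[OF A compact_operator_has_sum[OF T]])
qed

section \<open>Matrix units on the Fock space\<close>

text \<open>By adjointness, the coefficient at \<open>\<kappa>\<close> is the conjugate of the
  coefficient of \<open>ket (i # \<kappa>)\<close> at \<open>\<mu>\<close>.\<close>

lemma adj_left_creation_ket:
  "blinfun_apply (adj (left_creation i)) (ket \<mu>)
     = (case \<mu> of [] \<Rightarrow> 0 | j # \<nu> \<Rightarrow> if j = i then ket \<nu> else 0)"
proof (rule ell2_eqI)
  fix \<kappa>
  have "cnj (coord (blinfun_apply (adj (left_creation i)) (ket \<mu>)) \<kappa>) = coord (ket (i # \<kappa>)) \<mu>"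
    by (simp add: left_creation_ket cinner_ket
        flip: ket_cinner cinner_adj[OF left_creation_in_bounded_operators])
  then have "coord (blinfun_apply (adj (left_creation i)) (ket \<mu>)) \<kappa> = cnj (coord (ket (i # \<kappa>)) \<mu>)"
    by (metis complex_cnj_cnj)
  then show "coord (blinfun_apply (adj (left_creation i)) (ket \<mu>)) \<kappa>
      = coord (case \<mu> of [] \<Rightarrow> 0 | j # \<nu> \<Rightarrow> if j = i then ket \<nu> else 0) \<kappa>"
    by (auto simp: ket.rep_eq split: list.split)
qed

text \<open>The first term is the identity, written through generators because
  \<open>cstar_subalgebra\<close> does not demand a unit. The sum kills the vacuum and fixes every
  nonempty word, its only surviving term being the one for the leading letter.\<close>

lemma vacuum_projection:
  "rank_one (ket []) (ket [])
     = (adj (left_creation i) o\<^sub>L left_creation i)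
       - (\<Sum>j\<in>UNIV. left_creation j o\<^sub>L adj (left_creation j))"
  for i :: "'n::finite"
proof (rule bounded_operator_eqI)
  note B = cstar_subalgebra_bounded_operators[where 'a = "'n list"]
  have comp: "S o\<^sub>L T \<in> bounded_operators"
    if "S \<in> bounded_operators" "T \<in> bounded_operators" for S T :: "'n fock \<Rightarrow>\<^sub>L 'n fock"
    using B that by (simp add: cstar_subalgebra_def)
  show "(adj (left_creation i) o\<^sub>L left_creation i)
       - (\<Sum>j\<in>UNIV. left_creation j o\<^sub>L adj (left_creation j)) \<in> bounded_operators"
    by (intro cstar_subalgebra_diff[OF B] cstar_subalgebra_sum[OF B] comp
        adj_in_bounded_operators left_creation_in_bounded_operators)
  show "blinfun_apply (rank_one (ket []) (ket [])) (ket \<mu>)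
      = blinfun_apply ((adj (left_creation i) o\<^sub>L left_creation i)
       - (\<Sum>j\<in>UNIV. left_creation j o\<^sub>L adj (left_creation j))) (ket \<mu>)" for \<mu>
  proof (cases \<mu>)
    case Nil
    then show ?thesis
      by (simp add: rank_one.rep_eq cinner_ket ket.rep_eq blinfun.diff_left blinfun.sum_left
          left_creation_ket adj_left_creation_ket)
  next
    case (Cons k \<nu>)
    \<comment> \<open>Moving the operator inside the conditional lets the sum over \<open>j\<close>
      collapse to \<open>j = k\<close>.\<close>
    have "blinfun_apply (left_creation j) (if k = j then ket \<nu> else 0)
        = (if k = j then ket (k # \<nu>) else 0)" for j
      by (simp add: left_creation_ket)
    with Cons show ?thesis
      by (simp add: rank_one.rep_eq cinner_ket ket.rep_eq blinfun.diff_left blinfun.sum_left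
          left_creation_ket adj_left_creation_ket)
  qed
qed (rule rank_one_in_bounded_operators)

lemma matrix_units_in_cstar_subalgebra:
  fixes A :: "('n::finite fock \<Rightarrow>\<^sub>L 'n fock) set"
  assumes A: "cstar_subalgebra A" and S: "range left_creation \<subseteq> A"
  shows "rank_one (ket \<mu>) (ket \<nu>) \<in> A"
proof -
  have comp: "R o\<^sub>L T \<in> A" if "R \<in> A" "T \<in> A" for R T
    using A that by (simp add: cstar_subalgebra_def)
  have S: "left_creation i \<in> A" for i
    using S by auto
  then have S': "adj (left_creation i) \<in> A" for i
    using A by (simp add: cstar_subalgebra_def)
  \<comment> \<open>Left multiplication by a creation operator prepends a letter to the first word;
    right multiplication by its adjoint does so to the second.\<close>
  have left: "rank_one (ket (i # \<mu>)) x = left_creation i o\<^sub>L rank_one (ket \<mu>) x" for i \<mu> x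
    by (simp add: compose_rank_one left_creation_in_bounded_operators left_creation_ket)
  have right: "rank_one x (ket (i # \<nu>)) = rank_one x (ket \<nu>) o\<^sub>L adj (left_creation i)" for i \<nu> x
    by (simp add: rank_one_compose adj_in_bounded_operators adj_adj
        left_creation_in_bounded_operators left_creation_ket)
  have "rank_one (ket []) (ket []) \<in> A"
    \<comment> \<open>Any letter serves here, since each \<open>left_creation i\<close> is an
      isometry.\<close>
    unfolding vacuum_projection[of undefined]
    by (intro cstar_subalgebra_diff[OF A] cstar_subalgebra_sum[OF A] comp S S')
  then have "rank_one (ket []) (ket \<nu>) \<in> A"
    by (induction \<nu>) (simp_all add: right comp S')
  then show ?thesis
    by (induction \<mu>) (simp_all add: left comp S)
qed

theorem proposition3p1:
  fixes \<xi> :: "'n::{finite,linorder} fock" and W :: "'n fock \<Rightarrow>\<^sub>L 'n fock"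
  assumes "CARD('n) \<ge> 2"
    and "is_scalar_odometer \<xi> W"
  shows "compact_operators \<subseteq> cstar_generated (insert W (range left_creation))"
  \<comment> \<open>Every algebra in the intersection contains the creation operators, hence all
    matrix units and all compact operators.\<close>
  unfolding cstar_generated_def
  by (intro Inter_greatest compact_operators_subset_if_matrix_units
      matrix_units_in_cstar_subalgebra) auto

end
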